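(* Let $\nu>0$, $S>0$ and $\eta>0$ be fixed. For $0<\kappa<1$ let $\Xi=\Xi_\kappa$ be the interface parameter and $U=U_\kappa$ the profile of the relevant traveling wave with parameters $(\nu,\kappa,S,\eta)$. Then $$\Xi=\frac{\nu^2S\kappa}{2}\,\ln\left(1+\frac{2}{\nu^2S\eta}\right)\bigl(1+O(\kappa)\bigr)\qquad\text{as }\kappa\to0,$$ so in particular $\Xi\to0$ as $\kappa\to0$, and for every $X\in\mathbb{R}$ $$U(X)\;\xrightarrow{\;\kappa\to0\;}\;\frac{\eta}{\lambda_+}\bigl(\exp(\lambda_+X)-1\bigr)+\frac{2}{\sqrt{1+4\nu^2S^2}}\begin{cases}0&\text{for }X<0,\\ \exp(\lambda_+X)-\exp(\lambda_-X)&\text{for }X\ge0.\end{cases}$$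
   Context: Background: one considers increasing traveling waves $u(t,x)=U(x+St)$, $S>0$, of $\partial_t u-\nu^2\partial_x^2\partial_t u=\partial_x^2\Phi'(u)$, where $\Phi'(u)=u+1$ for $u\le-\kappa$, $\Phi'(u)=-\frac{1-\kappa}{\kappa}u$ for $-\kappa\le u\le\kappa$, $\Phi'(u)=u-1$ for $u\ge\kappa$. Exponential rates (note that $\lambda_\pm$ do not depend on $\kappa$): $$\lambda_\pm=-\frac{1}{2\nu^2S}\pm\sqrt{\Bigl(\frac{1}{2\nu^2S}\Bigr)^2+\frac1{\nu^2}},\qquad \mu_\pm=\frac{1-\kappa}{2\nu^2S\kappa}\pm\sqrt{\Bigl(\frac{1-\kappa}{2\nu^2S\kappa}\Bigr)^2+\frac1{\nu^2}}.$$ Traveling wave problem (with parameters $\nu,\kappa,S,\Xi$, where $\Xi>0$): set $I_-=(-\infty,-\Xi]$, $I_0=[-\Xi,\Xi]$, $I_+=[\Xi,\infty)$. A solution is a continuous function $V:\mathbb{R}\to\mathbb{R}$ that satisfies $$S\,V-\nu^2S\,V''=\bigl(V-c\,V\bigr)'$$ in the weak (distributional) sense on $\mathbb{R}$, where $c(X)=1/\kappa$ for $X\in I_0$ and $c(X)=0$ otherwise, and that satisfies the constraints $V(X)\ge0$ for all $X\in\mathbb{R}$ and $\int_{-\Xi}^{\Xi}V(X)\,dX=2\kappa$. Equivalently to the weak equation, $V$ is continuous, has the form $$V(X)=\begin{cases}A_-e^{\lambda_-X}+A_+e^{\lambda_+X}&X\in I_-,\\ B_-e^{\mu_-X}+B_+e^{\mu_+X}&X\in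 I_0,\\ C_-e^{\lambda_-X}+C_+e^{\lambda_+X}&X\in I_+,\end{cases}$$ with real coefficients, and the one-sided derivatives satisfy $V'(-\Xi-0)=V'(-\Xi+0)-\frac{1}{\nu^2S\kappa}V(-\Xi)$ and $V'(\Xi+0)=V'(\Xi-0)-\frac{1}{\nu^2S\kappa}V(\Xi)$. Relevant traveling wave with parameters $(\nu,\kappa,S,\eta)$, $\eta>0$: there exist a unique $\Xi>0$ and a unique solution $V$ of the traveling wave problem with parameters $\nu,\kappa,S,\Xi$ such that $V(X)=\eta\exp(\lambda_+(X+\Xi))$ for all $X\le-\Xi$ (it satisfies $A_-=0<A_+$, $B_-<0<B_+$, $C_\pm>0$). This $\Xi$ is the interface parameter of the wave, and the profile $U$ is the primitive of $V$ (so $U'=V$) normalized by $U(-\Xi)=-\kappa$; it then also satisfies $U(\Xi)=\kappa$. The implied constants in $O(\cdot)$ may depend on $\nu,S,\eta$ but not on $\kappa$. *)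

theory Defs
  imports "HOL-Analysis.Analysis" "HOL-Library.Landau_Symbols"
begin

definition lambda_plus :: "real \<Rightarrow> real \<Rightarrow> real" where
  "lambda_plus \<nu> S = - (1 / (2 * \<nu>\<^sup>2 * S)) + sqrt ((1 / (2 * \<nu>\<^sup>2 * S))\<^sup>2 + 1 / \<nu>\<^sup>2)"

definition lambda_minus :: "real \<Rightarrow> real \<Rightarrow> real" where
  "lambda_minus \<nu> S = - (1 / (2 * \<nu>\<^sup>2 * S)) - sqrt ((1 / (2 * \<nu>\<^sup>2 * S))\<^sup>2 + 1 / \<nu>\<^sup>2)"

definition test_function :: "(real \<Rightarrow> real) \<Rightarrow> bool" where
  "test_function \<phi> \<longleftrightarrow>
     (\<forall>n x. (deriv ^^ n) \<phi> differentiable (at x)) \<and> compact (closure {x. \<phi> x \<noteq> 0})"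

definition wave_coeff :: "real \<Rightarrow> real \<Rightarrow> real \<Rightarrow> real" where
  "wave_coeff \<kappa> \<Xi> X = (if X \<in> {-\<Xi>..\<Xi>} then 1 / \<kappa> else 0)"

(* S V - nu^2 S V'' = (V - c V)' as an identity of distributions: all derivatives of V and c V
   are moved onto the test function, with one sign change per integration by parts.  For
   continuous V every integrand is integrable. *)
definition weak_wave_equation ::
    "real \<Rightarrow> real \<Rightarrow> real \<Rightarrow> real \<Rightarrow> (real \<Rightarrow> real) \<Rightarrow> bool" where
  "weak_wave_equation \<nu> \<kappa> S \<Xi> V \<longleftrightarrow>
     (\<forall>\<phi>. test_function \<phi> \<longrightarrow>
        (LINT X|lborel. S * V X * \<phi> X) - (LINT X|lborel. \<nu>\<^sup>2 * S * V X * deriv (deriv \<phi>) X)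
        = - (LINT X|lborel. (V X - wave_coeff \<kappa> \<Xi> X * V X) * deriv \<phi> X))"

definition traveling_wave_solution ::
    "real \<Rightarrow> real \<Rightarrow> real \<Rightarrow> real \<Rightarrow> (real \<Rightarrow> real) \<Rightarrow> bool" where
  "traveling_wave_solution \<nu> \<kappa> S \<Xi> V \<longleftrightarrow>
     continuous_on UNIV V \<and>
     weak_wave_equation \<nu> \<kappa> S \<Xi> V \<and>
     (\<forall>X. 0 \<le> V X) \<and>
     integral {-\<Xi>..\<Xi>} V = 2 * \<kappa>"

definition relevant_wave ::
    "real \<Rightarrow> real \<Rightarrow> real \<Rightarrow> real \<Rightarrow> real \<Rightarrow> (real \<Rightarrow> real) \<Rightarrow> bool" where
  "relevant_wave \<nu> \<kappa> S \<eta> \<Xi> V \<longleftrightarrow>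
     0 < \<Xi> \<and>
     traveling_wave_solution \<nu> \<kappa> S \<Xi> V \<and>
     (\<forall>X \<le> -\<Xi>. V X = \<eta> * exp (lambda_plus \<nu> S * (X + \<Xi>)))"

definition wave_profile ::
    "real \<Rightarrow> real \<Rightarrow> (real \<Rightarrow> real) \<Rightarrow> (real \<Rightarrow> real) \<Rightarrow> bool" where
  "wave_profile \<kappa> \<Xi> V U \<longleftrightarrow>
     (\<forall>X. (U has_real_derivative V X) (at X)) \<and> U (-\<Xi>) = -\<kappa>"

end

theory Submission
  imports Defs
begin

text \<open>
  Why the expansion holds. Put \<open>N = \<nu>\<^sup>2 * S\<close>, let \<open>l\<close> and \<open>k\<close> be the positive and the negative
  outer exponential rate, let \<open>Y\<close> be the primitive of \<open>V\<close> that tends to \<open>0\<close> at minus infinity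
  (so \<open>Y = U + \<kappa> + \<eta> / l\<close>) and \<open>W\<close> the primitive of \<open>Y\<close> with the same decay. Integrated twice, the
  equation becomes an identity between continuous functions,
  \<open>N * V X = S * W X - Y X + C X\<close>, where \<open>C\<close> is \<open>1 / \<kappa>\<close> times the increase of \<open>Y\<close> from \<open>-\<Xi>\<close> to
  \<open>X\<close>, frozen outside the interface \<open>[-\<Xi>, \<Xi>]\<close>. A priori the two sides differ by an affine
  function (\<open>three_point_affine_if_weak_second_derivative_zero\<close>); it vanishes because it vanishes on
  the half-line where \<open>V\<close> is the prescribed exponential. The kinks of \<open>V\<close> at \<open>\<plusminus>\<Xi>\<close> are encoded in
  this identity: they come from the corners of \<open>C\<close>.

  Inside the interface \<open>Y\<close> grows by exactly \<open>2 * \<kappa>\<close>, and the identity says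
  \<open>V = \<eta> + m * (Y - \<eta> / l) + e\<close> with \<open>m = (1 - \<kappa>) / (N * \<kappa>)\<close>, where \<open>e\<close> is \<open>S / N\<close> times the
  increase of \<open>W\<close> since \<open>-\<Xi>\<close>. Since \<open>e \<ge> 0\<close>, one gets \<open>V \<ge> \<eta>\<close> and therefore \<open>\<Xi> \<le> \<kappa> / \<eta>\<close>, and
  then \<open>e\<close> itself, an integral of the bounded function \<open>Y\<close> over part of the interface, is
  \<open>O(\<kappa>)\<close>. So \<open>ln (\<eta> + m * (Y - \<eta> / l))\<close> has a derivative between \<open>m\<close> and \<open>m * (1 + K * \<kappa>)\<close> for
  some \<open>K\<close> independent of \<open>\<kappa>\<close>, while its total increase is \<open>ln (1 + (1 - \<kappa>) * 2 / (N * \<eta>))\<close>. The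
  mean value theorem turns this into two-sided bounds for \<open>2 * \<Xi>\<close> (\<open>interface_layer_bounds\<close>).
  Since \<open>ln\<close> is increasing and concave, that logarithm differs from \<open>ln (1 + 2 / (N * \<eta>))\<close> at most
  by a factor between \<open>1 - \<kappa>\<close> and \<open>1\<close>.

  To the right of the interface the same identity is a linear equation with rates \<open>l\<close> and \<open>k\<close>. Its
  data at \<open>\<Xi>\<close> are \<open>Y = \<eta> / l + 2 * \<kappa>\<close> and \<open>V = \<eta> + 2 / N + O(\<kappa>)\<close>: in the limit \<open>Y\<close> is
  continuous and its slope jumps by \<open>2 / N\<close>. This jump produces the second term of the limit
  profile, since \<open>(2 / N) / (l - k) = 2 / sqrt (1 + 4 * \<nu>\<^sup>2 * S\<^sup>2)\<close>.
\<close>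

section \<open>Smooth functions of compact support\<close>

text \<open>
  For \<open>p = 1\<close> this is the classical smooth function that is flat at \<open>0\<close>. The polynomial factor makes
  the family closed under differentiation, so that smoothness needs only one derivative.
\<close>

definition flat :: "real poly \<Rightarrow> real \<Rightarrow> real" where
  "flat p x = (if x \<le> 0 then 0 else poly p (1 / x) * exp (- (1 / x)))"

text \<open>
  The factor \<open>[:0, 0, 1:]\<close> is the square of \<open>1 / x\<close> that the chain rule produces.
\<close>

definition flat_deriv :: "real poly \<Rightarrow> real poly" where
  "flat_deriv p = [:0, 0, 1:] * (p - pderiv p)"

lemma poly_times_exp_minus_tendsto_0:
  fixes p :: "real poly"
  shows "((\<lambda>t. poly p t * exp (- t)) \<longlongrightarrow> 0) at_top"
proof -
  have "((\<lambda>t. \<Sum>i\<le>degree p. coeff p i * (t ^ i / exp t)) \<longlongrightarrow> (\<Sum>i\<le>degree p. coeff p i * 0)) at_top"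
    by (intro tendsto_sum tendsto_mult tendsto_const tendsto_power_div_exp_0)
  then show ?thesis
    by (simp add: poly_altdef sum_distrib_right sum_divide_distrib exp_minus field_simps)
qed

lemma flat_has_derivative: "(flat p has_real_derivative flat (flat_deriv p) x) (at x)"
proof -
  consider "x < 0" | "x = 0" | "x > 0" by linarith
  then show ?thesis
  proof cases
    case 1
    have "((\<lambda>_. 0) has_real_derivative 0) (at x)" by simp
    then have "(flat p has_real_derivative 0) (at x)"
      by (rule DERIV_cong_ev[THEN iffD1, rotated -1])
        (use 1 in \<open>auto intro!: eventually_mono[OF eventually_nhds_in_open[of "{..<0}"]] simp: flat_def\<close>)
    then show ?thesis using 1 by (simp add: flat_def)
  next
    case 3
    have "((\<lambda>x. poly p (1 / x) * exp (- (1 / x))) has_real_derivative flat (flat_deriv p) x) (at x)"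
      using 3 by (auto intro!: derivative_eq_intros poly_DERIV[THEN DERIV_chain2]
          simp: flat_def flat_deriv_def field_simps power2_eq_square)
    then show ?thesis
      by (rule DERIV_cong_ev[THEN iffD1, rotated -1])
        (use 3 in \<open>auto intro!: eventually_mono[OF eventually_nhds_in_open[of "{0<..}"]] simp: flat_def\<close>)
  next
    case 2
    have "((\<lambda>h. flat p h / h) \<longlongrightarrow> 0) (at_right 0)"
    proof -
      have "((\<lambda>h. poly (pCons 0 p) (inverse h) * exp (- inverse h)) \<longlongrightarrow> 0) (at_right 0)"
        by (rule filterlim_compose[OF poly_times_exp_minus_tendsto_0 filterlim_inverse_at_top_right])
      then show ?thesis
        by (rule tendsto_cong[THEN iffD1, rotated])
          (auto simp: eventually_at_filter flat_def field_simps)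
    qed
    moreover have "((\<lambda>h. flat p h / h) \<longlongrightarrow> 0) (at_left 0)"
      by (rule tendsto_eventually) (auto simp: eventually_at_filter flat_def)
    ultimately have "((\<lambda>h. flat p h / h) \<longlongrightarrow> 0) (at 0)"
      by (simp add: filterlim_split_at)
    then show ?thesis using 2 by (simp add: DERIV_def flat_def)
  qed
qed

text \<open>
  Products \<open>flat 1 (b - x) * flat 1 (x - a)\<close> are bumps on the interval from \<open>a\<close> to \<open>b\<close>. Translates,
  multiples and sums of them are again in the span, and by the product rule so are derivatives; all
  test functions below arise as double antiderivatives of its members.
\<close>

inductive_set bump_span :: "(real \<Rightarrow> real) set" where
  bump: "(\<lambda>x. k * (flat p (b - x) * flat q (x - a))) \<in> bump_span"
| sum: "f \<in> bump_span \<Longrightarrow> g \<in> bump_span \<Longrightarrow> (\<lambda>x. f x + g x) \<in> bump_span"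

lemma bump_span_has_derivative:
  assumes "f \<in> bump_span"
  shows "\<exists>f' \<in> bump_span. \<forall>x. (f has_real_derivative f' x) (at x)"
  using assms
proof induction
  case (bump k p b q a)
  have "(\<lambda>x. (- k) * (flat (flat_deriv p) (b - x) * flat q (x - a))
            + k * (flat p (b - x) * flat (flat_deriv q) (x - a))) \<in> bump_span"
    by (intro bump_span.intros)
  moreover have "((\<lambda>x. k * (flat p (b - x) * flat q (x - a))) has_real_derivative
      (- k) * (flat (flat_deriv p) (b - x) * flat q (x - a))
            + k * (flat p (b - x) * flat (flat_deriv q) (x - a))) (at x)" for x
    by (auto intro!: derivative_eq_intros DERIV_chain2[OF flat_has_derivative] simp: algebra_simps)
  ultimately show ?case by (intro bexI[rotated]) auto
next
  case (sum f g)
  then obtain f' g' where "f' \<in> bump_span" "g' \<in> bump_span"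
    "\<forall>x. (f has_real_derivative f' x) (at x)" "\<forall>x. (g has_real_derivative g' x) (at x)" by blast
  then show ?case
    by (intro bexI[of _ "\<lambda>x. f' x + g' x"]) (auto intro: bump_span.sum DERIV_add)
qed

lemma bump_span_smooth:
  assumes "f \<in> bump_span"
  shows "(deriv ^^ n) f \<in> bump_span" "(deriv ^^ n) f differentiable (at x)"
proof -
  show *: "(deriv ^^ n) f \<in> bump_span" for n
  proof (induction n)
    case (Suc n)
    then obtain f' where f': "f' \<in> bump_span" "\<forall>x. ((deriv ^^ n) f has_real_derivative f' x) (at x)"
      using bump_span_has_derivative by blast
    then have "deriv ((deriv ^^ n) f) = f'" by (auto intro: DERIV_imp_deriv)
    then show ?case using f' by simp
  qed (simp add: assms)
  show "(deriv ^^ n) f differentiable (at x)"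
    using bump_span_has_derivative[OF *] real_differentiable_def by blast
qed

text \<open>
  The test functions that are needed are specified by their second derivative, so only that one is
  required to belong to the span.
\<close>

lemma test_function_double_antiderivative:
  assumes "\<And>x. (\<phi> has_real_derivative \<psi> x) (at x)" "\<And>x. (\<psi> has_real_derivative \<rho> x) (at x)"
    and "\<rho> \<in> bump_span" and "\<And>x. x \<notin> {-R..R} \<Longrightarrow> \<phi> x = 0"
  shows "test_function \<phi>"
proof -
  have d: "deriv \<phi> = \<psi>" "deriv \<psi> = \<rho>" using assms(1,2) by (auto intro: DERIV_imp_deriv)
  have "(deriv ^^ n) \<phi> differentiable (at x)" for n x
  proof -
    consider "n = 0" | "n = 1" | k where "n = Suc (Suc k)"
      by (metis One_nat_def not0_implies_Suc)
    then show ?thesis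
    proof cases
      case 3
      then have "(deriv ^^ n) \<phi> = (deriv ^^ k) \<rho>"
        by (simp add: funpow_Suc_right d del: funpow.simps)
      then show ?thesis using bump_span_smooth(2)[OF assms(3)] by simp
    qed (use assms(1,2) d in \<open>auto simp: real_differentiable_def\<close>)
  qed
  moreover have "compact (closure {x. \<phi> x \<noteq> 0})"
  proof -
    have "{x. \<phi> x \<noteq> 0} \<subseteq> {-R..R}" using assms(4) by blast
    then show ?thesis using bounded_closed_interval bounded_subset compact_closure by blast
  qed
  ultimately show ?thesis by (simp add: test_function_def)
qed

section \<open>Continuous functions whose weak second derivative vanishes\<close>

lemma real_antiderivative:
  fixes f :: "real \<Rightarrow> real"
  assumes "continuous_on UNIV f"
  obtains F where "F a = c" "\<And>x. (F has_real_derivative f x) (at x)"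
proof -
  have "\<exists>F. \<forall>x::real. - \<infinity> < x \<longrightarrow> x < (\<infinity>::ereal) \<longrightarrow> (F has_vector_derivative f x) (at x)"
    using assms by (intro einterval_antiderivative) (auto simp: continuous_on_eq_continuous_at)
  then obtain F where "\<forall>x::real. - \<infinity> < x \<longrightarrow> x < (\<infinity>::ereal) \<longrightarrow> (F has_vector_derivative f x) (at x)"
    by (elim exE)
  then have F: "(F has_real_derivative f x) (at x)" for x
    by (simp add: has_real_derivative_iff_has_vector_derivative)
  have "((\<lambda>x. F x - F a + c) has_real_derivative f x) (at x)" for x
    by (auto intro!: derivative_eq_intros F)
  then show ?thesis by (intro that[of "\<lambda>x. F x - F a + c"]) simp_all
qed

lemma eq_on_if_same_derivative:
  fixes F G :: "real \<Rightarrow> real"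
  assumes F: "\<And>x. x \<in> A \<Longrightarrow> (F has_real_derivative f x) (at x)"
    and G: "\<And>x. x \<in> A \<Longrightarrow> (G has_real_derivative g x) (at x)"
    and fg: "\<And>x. x \<in> A \<Longrightarrow> f x = g x"
    and "convex A" "a \<in> A" "F a = G a" "x \<in> A"
  shows "F x = G x"
proof -
  have "((\<lambda>x. F x - G x) has_real_derivative 0) (at x within A)" if "x \<in> A" for x
    using DERIV_diff[OF F G, OF that that] fg[OF that] by (auto intro: has_field_derivative_at_within)
  then obtain c where c: "\<And>x. x \<in> A \<Longrightarrow> F x - G x = c"
    using has_field_derivative_zero_constant[OF \<open>convex A\<close>, of "\<lambda>x. F x - G x"] by blast
  have "F x - G x = F a - G a" using c[OF \<open>x \<in> A\<close>] c[OF \<open>a \<in> A\<close>] by simp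
  then show ?thesis using \<open>F a = G a\<close> by simp
qed

lemma lint_eq_integral_of_support:
  fixes f :: "real \<Rightarrow> real"
  assumes "set_integrable lborel {l..r} f" and "\<And>x. x \<notin> {l..r} \<Longrightarrow> f x = 0"
  shows "integrable lborel f" "(LINT x|lborel. f x) = integral {l..r} f" "f integrable_on {l..r}"
proof -
  have restrict: "(\<lambda>x. indicator {l..r} x *\<^sub>R f x) = f"
    using assms(2) by (auto simp: indicator_def fun_eq_iff)
  show "integrable lborel f"
    using assms(1) unfolding set_integrable_def restrict .
  show "(LINT x|lborel. f x) = integral {l..r} f"
    using set_borel_integral_eq_integral(2)[OF assms(1)]
    unfolding set_lebesgue_integral_def restrict .
  show "f integrable_on {l..r}"
    by (rule set_borel_integral_eq_integral(1)[OF assms(1)])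
qed

text \<open>
  The second-order lemma of du Bois-Reymond, in the form of three collinear points. For
  a small bump \<open>w\<close> around \<open>0\<close> let \<open>Q\<close> be its double antiderivative, which is \<open>0\<close> on the left and
  affine on the right of the bump. The combination of the translates of \<open>Q\<close> to \<open>a\<close>, \<open>b\<close>, \<open>c\<close> with
  coefficients \<open>c - b\<close>, \<open>-(c - a)\<close>, \<open>b - a\<close> has compact support, because these coefficients
  annihilate affine functions. Testing with it shows that \<open>w\<close> integrates to \<open>0\<close> against the
  function \<open>D\<close> that takes the same combination of values of \<open>h\<close> around a moving base point. If
  \<open>D 0\<close> were nonzero, \<open>D\<close> would have a sign on the support of \<open>w\<close>.
\<close>

lemma three_point_affine_if_weak_second_derivative_zero:
  fixes h :: "real \<Rightarrow> real"
  assumes cont: "continuous_on UNIV h"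
    and weak: "\<And>\<phi>. test_function \<phi> \<Longrightarrow> (LINT x|lborel. h x * deriv (deriv \<phi>) x) = 0"
    and abc: "a < b" "b < c"
  shows "(c - b) * h a - (c - a) * h b + (b - a) * h c = 0"
proof (rule ccontr)
  define D where "D y = (c - b) * h (y + a) - (c - a) * h (y + b) + (b - a) * h (y + c)" for y
  define s where "s = sgn (D 0)"
  assume "\<not> ?thesis"
  then have s: "s * D 0 > 0" by (auto simp: D_def s_def sgn_if)
  have conth: "continuous_on UNIV (\<lambda>y. h (y + t))" for t
    by (intro continuous_on_compose2[OF cont]) (auto intro!: continuous_intros)
  have contD: "continuous_on UNIV (\<lambda>y. s * D y)"
    unfolding D_def by (intro continuous_intros conth)
  then obtain d where d: "d > 0" "\<And>y. dist y 0 < d \<Longrightarrow> dist (s * D y) (s * D 0) < s * D 0"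
    using continuous_on_iff[THEN iffD1, rule_format, OF contD UNIV_I s] by blast
  have d': "s * D y > 0" if "\<bar>y\<bar> < d" for y
    using d(2)[of y] s that by (auto simp: dist_real_def)
  define e where "e = d / 2"
  have e: "e > 0" "\<And>y. y \<in> {-e..e} \<Longrightarrow> s * D y > 0" using d(1) d' by (auto simp: e_def)
  define w where "w x = flat 1 (e - x) * flat 1 (x + e)" for x
  have w_span: "(\<lambda>x. k * w (x - t)) \<in> bump_span" for k t
    using bump_span.bump[of k 1 "e + t" 1 "t - e"] by (simp add: w_def algebra_simps)
  have w_nonneg: "w x \<ge> 0" and w_out: "x \<notin> {-e<..<e} \<Longrightarrow> w x = 0" and w0: "w 0 > 0" for x
    using e(1) by (auto simp: w_def flat_def)
  have contw: "continuous_on UNIV w"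
  proof -
    have "continuous_on UNIV (flat 1)"
      by (meson flat_has_derivative DERIV_isCont continuous_at_imp_continuous_on)
    note flat_cont = continuous_on_compose2[OF this _ subset_UNIV]
    show ?thesis
      unfolding w_def by (intro continuous_on_mult flat_cont continuous_intros)
  qed
  have contw_shift: "continuous_on UNIV (\<lambda>x. w (x - t))" for t
    by (intro continuous_on_compose2[OF contw]) (auto intro!: continuous_intros)
  obtain P where P: "P (-e) = 0" "\<And>x. (P has_real_derivative w x) (at x)"
    using real_antiderivative[OF contw, where a = "-e" and c = 0] by blast
  then have contP: "continuous_on UNIV P"
    by (meson DERIV_isCont continuous_at_imp_continuous_on)
  obtain Q where Q: "Q (-e) = 0" "\<And>x. (Q has_real_derivative P x) (at x)"
    using real_antiderivative[OF contP, where a = "-e" and c = 0] by blast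
  have P_left: "P x = 0" if "x \<le> -e" for x
    by (rule eq_on_if_same_derivative[where A = "{..-e}" and G = "\<lambda>_. 0" and a = "-e", OF P(2) DERIV_const])
      (use that P(1) w_out in auto)
  have P_right: "P x = P e" if "x \<ge> e" for x
    by (rule eq_on_if_same_derivative[where A = "{e..}" and G = "\<lambda>_. P e" and a = e, OF P(2) DERIV_const])
      (use that w_out in auto)
  have Q_left: "Q x = 0" if "x \<le> -e" for x
    by (rule eq_on_if_same_derivative[where A = "{..-e}" and G = "\<lambda>_. 0" and a = "-e", OF Q(2) DERIV_const])
      (use that Q(1) P_left in auto)
  have Q_right: "Q x = Q e + P e * (x - e)" if "x \<ge> e" for x
  proof (rule eq_on_if_same_derivative[where A = "{e..}" and a = e, OF Q(2)])
    show "((\<lambda>x. Q e + P e * (x - e)) has_real_derivative P e) (at y)" for y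
      by (auto intro!: derivative_eq_intros)
    show "P y = P e" if "y \<in> {e..}" for y
      using P_right[of y] that by simp
  qed (use that in auto)
  \<comment> \<open>Beyond all three bumps the affine pieces of the translates cancel.\<close>
  define \<phi> where "\<phi> x = (c - b) * Q (x - a) - (c - a) * Q (x - b) + (b - a) * Q (x - c)" for x
  define \<psi> where "\<psi> x = (c - b) * P (x - a) - (c - a) * P (x - b) + (b - a) * P (x - c)" for x
  define \<rho> where "\<rho> x = (c - b) * w (x - a) + (-(c - a)) * w (x - b) + (b - a) * w (x - c)" for x
  have d1: "(\<phi> has_real_derivative \<psi> x) (at x)" for x
    unfolding \<phi>_def \<psi>_def by (auto intro!: derivative_eq_intros DERIV_chain2[OF Q(2)] simp: algebra_simps)
  have d2: "(\<psi> has_real_derivative \<rho> x) (at x)" for x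
    unfolding \<psi>_def \<rho>_def by (auto intro!: derivative_eq_intros DERIV_chain2[OF P(2)] simp: algebra_simps)
  have "\<rho> \<in> bump_span"
    unfolding \<rho>_def by (intro bump_span.sum w_span)
  have "\<phi> x = 0" if "x \<notin> {- (\<bar>a\<bar> + \<bar>c\<bar> + e).. \<bar>a\<bar> + \<bar>c\<bar> + e}" for x
  proof -
    have "x < - (\<bar>a\<bar> + \<bar>c\<bar> + e) \<or> \<bar>a\<bar> + \<bar>c\<bar> + e < x" using that by auto
    then have "x \<le> a - e \<or> x \<ge> c + e" by linarith
    then consider "x \<le> a - e" | "x \<ge> c + e" by blast
    then show ?thesis
    proof cases
      case 1 then show ?thesis using abc by (simp add: \<phi>_def Q_left)
    next
      case 2
      then have Qs: "Q (x - a) = Q e + P e * (x - a - e)" "Q (x - b) = Q e + P e * (x - b - e)"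
        "Q (x - c) = Q e + P e * (x - c - e)" using abc by (auto intro: Q_right)
      show ?thesis unfolding \<phi>_def Qs by (simp add: algebra_simps)
    qed
  qed
  with d1 d2 \<open>\<rho> \<in> bump_span\<close> have "test_function \<phi>"
    by (rule test_function_double_antiderivative)
  then have "(LINT x|lborel. h x * deriv (deriv \<phi>) x) = 0" by (rule weak)
  moreover have "deriv \<phi> = \<psi>" "deriv \<psi> = \<rho>" by (intro ext DERIV_imp_deriv d1 d2)+
  ultimately have zero: "(LINT x|lborel. h x * \<rho> x) = 0" by simp
  have contDw: "continuous_on {-e..e} (\<lambda>y. s * D y * w y)"
    by (intro continuous_on_mult continuous_on_subset[OF contD] continuous_on_subset[OF contw] subset_UNIV)
  have intg: "integrable lborel (\<lambda>x. h x * w (x - t))" for t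
  proof (rule lint_eq_integral_of_support)
    have "continuous_on {t - e..t + e} (\<lambda>x. h x * w (x - t))"
      by (intro continuous_on_mult continuous_on_subset[OF cont] continuous_on_subset[OF contw_shift] subset_UNIV)
    then show "set_integrable lborel {t - e..t + e} (\<lambda>x. h x * w (x - t))"
      by (rule borel_integrable_atLeastAtMost')
    show "h x * w (x - t) = 0" if "x \<notin> {t - e..t + e}" for x
      using w_out[of "x - t"] that by auto
  qed
  have intg': "integrable lborel (\<lambda>y. h (y + t) * w y)" for t
    using lborel_integrable_real_affine[OF intg[of t], of 1 t] by (simp add: algebra_simps)
  have shift: "(LINT x|lborel. h x * w (x - t)) = (LINT y|lborel. h (y + t) * w y)" for t
    by (subst lborel_integral_real_affine[where c = 1 and t = t]) (simp_all add: algebra_simps)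
  have "0 = (c - b) * (LINT x|lborel. h x * w (x - a)) - (c - a) * (LINT x|lborel. h x * w (x - b))
           + (b - a) * (LINT x|lborel. h x * w (x - c))"
  proof -
    have "(\<lambda>x. h x * \<rho> x) = (\<lambda>x. (c - b) * (h x * w (x - a)) - (c - a) * (h x * w (x - b))
        + (b - a) * (h x * w (x - c)))"
      by (simp add: \<rho>_def fun_eq_iff algebra_simps)
    then show ?thesis using zero intg by simp
  qed
  also have "\<dots> = (LINT y|lborel. (c - b) * (h (y + a) * w y) - (c - a) * (h (y + b) * w y)
           + (b - a) * (h (y + c) * w y))"
    using intg' by (simp add: shift)
  also have "\<dots> = (LINT y|lborel. D y * w y)" by (simp add: D_def algebra_simps)
  finally have "0 = s * (LINT y|lborel. D y * w y)" by simp
  also have "\<dots> = (LINT y|lborel. s * D y * w y)"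
    by (simp add: mult.assoc)
  also have "\<dots> = integral {-e..e} (\<lambda>y. s * D y * w y)"
    by (intro lint_eq_integral_of_support(2) borel_integrable_atLeastAtMost' contDw) (use w_out in auto)
  finally have "integral {-e..e} (\<lambda>y. s * D y * w y) = 0" by simp
  moreover have "s * D y * w y \<ge> 0" if "y \<in> {-e..e}" for y
    by (intro mult_nonneg_nonneg less_imp_le[OF e(2)] w_nonneg that)
  ultimately have "\<forall>y \<in> {-e..e}. s * D y * w y = 0"
    using integral_eq_0_iff[OF contDw] e(1) by simp
  then have "s * D 0 * w 0 = 0" using e(1) by auto
  then show False using s w0 by auto
qed

section \<open>Outer exponential rates\<close>

lemma lambda_roots:
  assumes "0 < \<nu>" "0 < S"
  shows lambda_plus_pos: "0 < lambda_plus \<nu> S"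
    and lambda_sum: "lambda_plus \<nu> S + lambda_minus \<nu> S = - 1 / (\<nu>\<^sup>2 * S)"
    and lambda_prod: "lambda_plus \<nu> S * lambda_minus \<nu> S = - 1 / \<nu>\<^sup>2"
    and lambda_gap: "lambda_plus \<nu> S - lambda_minus \<nu> S = sqrt (1 + 4 * \<nu>\<^sup>2 * S\<^sup>2) / (\<nu>\<^sup>2 * S)"
proof -
  define b where "b = 1 / (2 * \<nu>\<^sup>2 * S)"
  define d where "d = sqrt (b\<^sup>2 + 1 / \<nu>\<^sup>2)"
  have l: "lambda_plus \<nu> S = - b + d" "lambda_minus \<nu> S = - b - d"
    by (simp_all add: lambda_plus_def lambda_minus_def b_def d_def)
  have "b > 0" using assms by (simp add: b_def)
  have d2: "d\<^sup>2 = b\<^sup>2 + 1 / \<nu>\<^sup>2" by (simp add: d_def)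
  have "b\<^sup>2 < b\<^sup>2 + 1 / \<nu>\<^sup>2" using assms by simp
  then have "sqrt (b\<^sup>2) < d" unfolding d_def by (rule real_sqrt_less_mono)
  then show "0 < lambda_plus \<nu> S" using \<open>b > 0\<close> by (simp add: l)
  show "lambda_plus \<nu> S + lambda_minus \<nu> S = - 1 / (\<nu>\<^sup>2 * S)"
    by (simp add: l b_def)
  have "lambda_plus \<nu> S * lambda_minus \<nu> S = b\<^sup>2 - d\<^sup>2"
    by (simp add: l power2_eq_square algebra_simps)
  then show "lambda_plus \<nu> S * lambda_minus \<nu> S = - 1 / \<nu>\<^sup>2"
    by (simp add: d2)
  have "b\<^sup>2 + 1 / \<nu>\<^sup>2 = (1 + 4 * \<nu>\<^sup>2 * S\<^sup>2) / (2 * \<nu>\<^sup>2 * S)\<^sup>2"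
    using assms by (simp add: b_def power2_eq_square field_simps)
  then have "d = sqrt (1 + 4 * \<nu>\<^sup>2 * S\<^sup>2) / (2 * \<nu>\<^sup>2 * S)"
    using assms by (simp add: d_def real_sqrt_divide)
  then show "lambda_plus \<nu> S - lambda_minus \<nu> S = sqrt (1 + 4 * \<nu>\<^sup>2 * S\<^sup>2) / (\<nu>\<^sup>2 * S)"
    by (simp add: l)
qed

section \<open>The traveling wave equation integrated twice\<close>

lemma test_function_derivatives:
  assumes "test_function \<phi>"
  shows "(\<phi> has_real_derivative deriv \<phi> x) (at x)"
    and "(deriv \<phi> has_real_derivative deriv (deriv \<phi>) x) (at x)"
    and "continuous_on UNIV (deriv (deriv \<phi>))"
proof -
  have diff: "(deriv ^^ n) \<phi> differentiable (at x)" for n x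
    using assms by (simp add: test_function_def)
  show "(\<phi> has_real_derivative deriv \<phi> x) (at x)"
    using diff[of 0 x] by (simp add: DERIV_deriv_iff_real_differentiable)
  show "(deriv \<phi> has_real_derivative deriv (deriv \<phi>) x) (at x)"
    using diff[of 1 x] by (simp add: DERIV_deriv_iff_real_differentiable)
  have "isCont (deriv (deriv \<phi>)) x" for x
    using diff[of 2 x] by (simp add: numeral_2_eq_2 differentiable_imp_continuous_within)
  then show "continuous_on UNIV (deriv (deriv \<phi>))"
    by (simp add: continuous_at_imp_continuous_on)
qed

lemma deriv_eq_0_outside:
  fixes f :: "real \<Rightarrow> real"
  assumes "\<And>x. \<bar>x\<bar> > B \<Longrightarrow> f x = 0" and "\<bar>x\<bar> > B"
  shows "deriv f x = 0"
proof (rule DERIV_imp_deriv)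
  have "open {x::real. \<bar>x\<bar> > B}"
    by (intro open_Collect_less continuous_intros)
  from eventually_nhds_in_open[OF this, of x] have "\<forall>\<^sub>F y in nhds x. f y = 0"
    using assms by (auto elim: eventually_mono)
  then have "(f has_real_derivative 0) (at x) \<longleftrightarrow> ((\<lambda>_. 0) has_real_derivative (0::real)) (at x)"
    by (intro DERIV_cong_ev) auto
  then show "(f has_real_derivative 0) (at x)" by simp
qed

text \<open>
  One interval serves for the test function and its first two derivatives. It may be taken larger
  than any given \<open>r\<close>, so that it covers the interface.
\<close>

lemma test_function_support:
  assumes "test_function \<phi>"
  obtains R where "R > r" "R > 0"
    "\<And>x. x \<notin> {-R<..<R} \<Longrightarrow> \<phi> x = 0 \<and> deriv \<phi> x = 0 \<and> deriv (deriv \<phi>) x = 0"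
proof -
  have "bounded {x. \<phi> x \<noteq> 0}"
    using assms by (simp add: test_function_def)
  then obtain B where "\<forall>x \<in> {x. \<phi> x \<noteq> 0}. norm x \<le> B" by (auto simp: bounded_iff)
  then have B: "\<phi> x = 0" if "\<bar>x\<bar> > B" for x using that by force
  have B': "deriv \<phi> x = 0" if "\<bar>x\<bar> > B" for x by (rule deriv_eq_0_outside[OF B that])
  have B'': "deriv (deriv \<phi>) x = 0" if "\<bar>x\<bar> > B" for x by (rule deriv_eq_0_outside[OF B' that])
  define R where "R = \<bar>r\<bar> + \<bar>B\<bar> + 1"
  show ?thesis
  proof (rule that)
    show "R > r" "R > 0" by (auto simp: R_def)
    fix x assume "x \<notin> {-R<..<R}"
    then have "x \<le> -R \<or> x \<ge> R" by auto
    then have "\<bar>x\<bar> > B" unfolding R_def by linarith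
    then show "\<phi> x = 0 \<and> deriv \<phi> x = 0 \<and> deriv (deriv \<phi>) x = 0" using B B' B'' by blast
  qed
qed

text \<open>
  Freezing \<open>Y\<close> outside the interface gives a continuous primitive of the discontinuous term
  \<open>wave_coeff \<kappa> \<Xi> X * V X\<close>, with the two jump points as the only exceptions.
\<close>

lemma frozen_primitive_has_derivative:
  fixes Y :: "real \<Rightarrow> real"
  assumes "\<And>x. (Y has_real_derivative V x) (at x)" "X \<notin> {-\<Xi>, \<Xi>}" "0 < \<Xi>" "0 < \<kappa>"
  shows "((\<lambda>X. (Y (max (-\<Xi>) (min \<Xi> X)) - Y (-\<Xi>)) / \<kappa>) has_real_derivative
           wave_coeff \<kappa> \<Xi> X * V X) (at X)"
proof -
  consider "X < -\<Xi>" | "-\<Xi> < X" "X < \<Xi>" | "X > \<Xi>" using assms(2) by fastforce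
  then show ?thesis
  proof cases
    case 1
    have ev: "\<forall>\<^sub>F x in nhds X. (Y (max (-\<Xi>) (min \<Xi> x)) - Y (-\<Xi>)) / \<kappa> = 0"
      by (rule eventually_mono[OF eventually_nhds_in_open[of "{..<-\<Xi>}"]]) (use 1 assms(3) in auto)
    have "((\<lambda>_. 0) has_real_derivative (0::real)) (at X)" by simp
    then have "((\<lambda>X. (Y (max (-\<Xi>) (min \<Xi> X)) - Y (-\<Xi>)) / \<kappa>) has_real_derivative 0) (at X)"
      using DERIV_cong_ev[OF refl ev refl] by blast
    then show ?thesis using 1 by (simp add: wave_coeff_def)
  next
    case 2
    have ev: "\<forall>\<^sub>F x in nhds X. (Y (max (-\<Xi>) (min \<Xi> x)) - Y (-\<Xi>)) / \<kappa> = (Y x - Y (-\<Xi>)) / \<kappa>"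
      by (rule eventually_mono[OF eventually_nhds_in_open[of "{-\<Xi><..<\<Xi>}"]]) (use 2 in auto)
    have "((\<lambda>x. (Y x - Y (-\<Xi>)) / \<kappa>) has_real_derivative V X / \<kappa>) (at X)"
      using \<open>0 < \<kappa>\<close> by (auto intro!: derivative_eq_intros assms(1))
    then have "((\<lambda>X. (Y (max (-\<Xi>) (min \<Xi> X)) - Y (-\<Xi>)) / \<kappa>) has_real_derivative V X / \<kappa>) (at X)"
      using DERIV_cong_ev[OF refl ev refl] by blast
    then show ?thesis using 2 by (simp add: wave_coeff_def)
  next
    case 3
    have ev: "\<forall>\<^sub>F x in nhds X. (Y (max (-\<Xi>) (min \<Xi> x)) - Y (-\<Xi>)) / \<kappa> = (Y \<Xi> - Y (-\<Xi>)) / \<kappa>"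
      by (rule eventually_mono[OF eventually_nhds_in_open[of "{\<Xi><..}"]]) (use 3 assms(3) in auto)
    have "((\<lambda>_. (Y \<Xi> - Y (-\<Xi>)) / \<kappa>) has_real_derivative (0::real)) (at X)" by simp
    then have "((\<lambda>X. (Y (max (-\<Xi>) (min \<Xi> X)) - Y (-\<Xi>)) / \<kappa>) has_real_derivative 0) (at X)"
      using DERIV_cong_ev[OF refl ev refl] by blast
    then show ?thesis using 3 by (simp add: wave_coeff_def)
  qed
qed

text \<open>
  All terms of the weak equation are moved onto the second derivative of the test function by
  integration by parts; what results says that one continuous function has vanishing weak second
  derivative.
\<close>

lemma weak_wave_equation_twice_integrated:
  assumes "0 < \<kappa>" "0 < \<Xi>"
    and contV: "continuous_on UNIV V"
    and weak: "weak_wave_equation \<nu> \<kappa> S \<Xi> V"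
    and Y: "\<And>X. (Y has_real_derivative V X) (at X)"
    and W: "\<And>X. (W has_real_derivative Y X) (at X)"
    and C_def: "\<And>X. C X = (Y (max (-\<Xi>) (min \<Xi> X)) - Y (-\<Xi>)) / \<kappa>"
    and \<phi>: "test_function \<phi>"
  shows "(LINT X|lborel. (S * W X - \<nu>\<^sup>2 * S * V X - Y X + C X) * deriv (deriv \<phi>) X) = 0"
proof -
  define p where "p = deriv \<phi>"
  define q where "q = deriv (deriv \<phi>)"
  note d\<phi> = test_function_derivatives(1)[OF \<phi>, folded p_def]
  note dp = test_function_derivatives(2)[OF \<phi>, folded q_def, folded p_def]
  note contq = test_function_derivatives(3)[OF \<phi>, folded q_def]
  obtain R where R: "R > \<Xi>" "R > 0" and out0: "\<And>x. x \<notin> {-R<..<R} \<Longrightarrow> \<phi> x = 0 \<and> p x = 0 \<and> q x = 0"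
    using test_function_support[OF \<phi>, of \<Xi>] unfolding p_def q_def by blast
  have out: "\<phi> x = 0" "p x = 0" "q x = 0" if "x \<notin> {-R<..<R}" for x
    using out0[OF that] by auto
  have cont: "continuous_on UNIV f" if "\<And>x. (f has_real_derivative g x) (at x)" for f g :: "real \<Rightarrow> real"
    by (meson that DERIV_isCont continuous_at_imp_continuous_on)
  note cont\<phi> = cont[OF d\<phi>] and contp = cont[OF dp] and contY = cont[OF Y] and contW = cont[OF W]
  have contC: "continuous_on UNIV C"
  proof -
    have "continuous_on UNIV (\<lambda>X. Y (max (-\<Xi>) (min \<Xi> X)))"
      by (rule continuous_on_compose2[OF contY]) (auto intro!: continuous_intros)
    then show ?thesis unfolding C_def using \<open>0 < \<kappa>\<close> by (intro continuous_intros) auto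
  qed
  have compact_integrable: "integrable lborel f" "(LINT x|lborel. f x) = integral {-R..R} f"
      "f integrable_on {-R..R}"
    if "continuous_on UNIV f" "\<And>x. x \<notin> {-R<..<R} \<Longrightarrow> f x = 0" for f :: "real \<Rightarrow> real"
  proof -
    have si: "set_integrable lborel {-R..R} f"
      by (rule borel_integrable_atLeastAtMost'[OF continuous_on_subset[OF that(1) subset_UNIV]])
    have "f x = 0" if "x \<notin> {-R..R}" for x
      using \<open>\<And>x. x \<notin> {-R<..<R} \<Longrightarrow> f x = 0\<close>[of x] that by auto
    note lint_eq_integral_of_support[OF si this]
    then show "integrable lborel f" "(LINT x|lborel. f x) = integral {-R..R} f"
      "f integrable_on {-R..R}" by blast+
  qed
  let ?f1 = "\<lambda>X. S * V X * \<phi> X"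
  let ?f2 = "\<lambda>X. \<nu>\<^sup>2 * S * V X * q X"
  let ?f3 = "\<lambda>X. (V X - wave_coeff \<kappa> \<Xi> X * V X) * p X"
  let ?f4 = "\<lambda>X. (S * W X - \<nu>\<^sup>2 * S * V X - Y X + C X) * q X"
  have f1: "(LINT X|lborel. ?f1 X) = integral {-R..R} ?f1" "?f1 integrable_on {-R..R}"
    using out by (intro compact_integrable(2,3) continuous_intros contV cont\<phi>; simp)+
  have f2: "(LINT X|lborel. ?f2 X) = integral {-R..R} ?f2" "?f2 integrable_on {-R..R}"
    using out by (intro compact_integrable(2,3) continuous_intros contV contq; simp)+
  have f4: "(LINT X|lborel. ?f4 X) = integral {-R..R} ?f4" "?f4 integrable_on {-R..R}"
    using out by (intro compact_integrable(2,3) continuous_intros contV contW contY contC contq; simp)+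
  have f3: "(LINT X|lborel. ?f3 X) = integral {-R..R} ?f3" "?f3 integrable_on {-R..R}"
  proof -
    have f3_eq: "?f3 = (\<lambda>X. V X * p X - indicator {-\<Xi>..\<Xi>} X *\<^sub>R (V X * p X / \<kappa>))"
      by (auto simp: fun_eq_iff wave_coeff_def indicator_def algebra_simps)
    have "integrable lborel (\<lambda>X. V X * p X)"
      using out by (intro compact_integrable(1) continuous_intros contV contp; simp)
    then have "integrable lborel ?f3"
      unfolding f3_eq by (intro Bochner_Integration.integrable_diff integrable_mult_indicator) auto
    then have "set_integrable lborel {-R..R} ?f3"
      unfolding set_integrable_def by (intro integrable_mult_indicator) auto
    moreover have "?f3 X = 0" if "X \<notin> {-R..R}" for X
      using out(2)[of X] that by auto
    ultimately show "(LINT X|lborel. ?f3 X) = integral {-R..R} ?f3" "?f3 integrable_on {-R..R}"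
      using lint_eq_integral_of_support[of "-R" R ?f3] by blast+
  qed
  \<comment> \<open>Boundary terms of all the integrations by parts; their derivative is the difference of integrands.\<close>
  define T where "T X = S * (Y X * \<phi> X - W X * p X) + Y X * p X - C X * p X" for X
  have "(T has_real_derivative ?f1 X + ?f3 X - ?f2 X - ?f4 X) (at X)" if "X \<notin> {-\<Xi>, \<Xi>}" for X
  proof -
    have "(C has_real_derivative wave_coeff \<kappa> \<Xi> X * V X) (at X)"
      using frozen_primitive_has_derivative[OF Y that \<open>0 < \<Xi>\<close> \<open>0 < \<kappa>\<close>] unfolding C_def .
    then show ?thesis
      unfolding T_def by (auto intro!: derivative_eq_intros Y W d\<phi> dp simp: algebra_simps)
  qed
  moreover have "continuous_on {-R..R} T"
    unfolding T_def
    by (intro continuous_intros continuous_on_subset[OF contY] continuous_on_subset[OF contW]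
        continuous_on_subset[OF contC] continuous_on_subset[OF contp] continuous_on_subset[OF cont\<phi>] subset_UNIV)
  ultimately have "((\<lambda>X. ?f1 X + ?f3 X - ?f2 X - ?f4 X) has_integral (T R - T (-R))) {-R..R}"
    using R by (intro fundamental_theorem_of_calculus_interior_strong[where S = "{-\<Xi>, \<Xi>}"])
      (auto simp: has_real_derivative_iff_has_vector_derivative[symmetric])
  moreover have "T R = 0" "T (-R) = 0" using out by (auto simp: T_def)
  ultimately have "integral {-R..R} (\<lambda>X. ?f1 X + ?f3 X - ?f2 X - ?f4 X) = 0"
    by (simp add: integral_unique)
  moreover have "integral {-R..R} (\<lambda>X. ?f1 X + ?f3 X - ?f2 X - ?f4 X)
      = integral {-R..R} ?f1 + integral {-R..R} ?f3 - integral {-R..R} ?f2 - integral {-R..R} ?f4"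
    by (intro integral_unique has_integral_diff has_integral_add integrable_integral f1(2) f2(2) f3(2) f4(2))
  moreover have "(LINT X|lborel. ?f1 X) - (LINT X|lborel. ?f2 X) = - (LINT X|lborel. ?f3 X)"
    using weak \<phi> unfolding weak_wave_equation_def p_def q_def by blast
  ultimately have "(LINT X|lborel. ?f4 X) = 0" using f1(1) f2(1) f3(1) f4(1) by linarith
  then show ?thesis by (simp add: q_def)
qed

text \<open>
  The two initial values select the primitives that decay at minus infinity; for them both sides of
  the identity are multiples of the same exponential on the left of the interface, and they agree
  because \<open>l\<close> is a root of \<open>\<nu>\<^sup>2 * S * l\<^sup>2 + l - S\<close>.
\<close>

lemma relevant_wave_integrated:
  fixes \<nu> S \<eta> \<kappa> \<Xi> :: real and V Y W :: "real \<Rightarrow> real"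
  defines "l \<equiv> lambda_plus \<nu> S"
  assumes pos: "0 < \<nu>" "0 < S" "0 < \<kappa>"
    and wave: "relevant_wave \<nu> \<kappa> S \<eta> \<Xi> V"
    and Y: "\<And>X. (Y has_real_derivative V X) (at X)" and Y0: "Y (-\<Xi>) = \<eta> / l"
    and W: "\<And>X. (W has_real_derivative Y X) (at X)" and W0: "W (-\<Xi>) = \<eta> / l\<^sup>2"
  shows "X \<le> -\<Xi> \<Longrightarrow> Y X = \<eta> / l * exp (l * (X + \<Xi>))"
    and "\<nu>\<^sup>2 * S * V X = S * W X - Y X + (Y (max (-\<Xi>) (min \<Xi> X)) - Y (-\<Xi>)) / \<kappa>"
proof -
  have l: "l > 0" using lambda_plus_pos[OF pos(1,2)] by (simp add: l_def)
  have \<Xi>: "0 < \<Xi>" and Vc: "continuous_on UNIV V" and weak: "weak_wave_equation \<nu> \<kappa> S \<Xi> V"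
    and Vl: "\<And>X. X \<le> -\<Xi> \<Longrightarrow> V X = \<eta> * exp (l * (X + \<Xi>))"
    using wave by (auto simp: relevant_wave_def traveling_wave_solution_def l_def)
  show Yl: "Y X = \<eta> / l * exp (l * (X + \<Xi>))" if "X \<le> -\<Xi>" for X
  proof (rule eq_on_if_same_derivative[where A = "{..-\<Xi>}" and a = "-\<Xi>", OF Y])
    show "((\<lambda>X. \<eta> / l * exp (l * (X + \<Xi>))) has_real_derivative \<eta> * exp (l * (x + \<Xi>))) (at x)" for x
      using l by (auto intro!: derivative_eq_intros)
  qed (use that Y0 Vl in auto)
  have Wl: "W X = \<eta> / l\<^sup>2 * exp (l * (X + \<Xi>))" if "X \<le> -\<Xi>" for X
  proof (rule eq_on_if_same_derivative[where A = "{..-\<Xi>}" and a = "-\<Xi>", OF W])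
    show "((\<lambda>X. \<eta> / l\<^sup>2 * exp (l * (X + \<Xi>))) has_real_derivative \<eta> / l * exp (l * (x + \<Xi>))) (at x)" for x
      using l by (auto intro!: derivative_eq_intros simp: power2_eq_square)
  qed (use that W0 Yl in auto)
  define C where "C X = (Y (max (-\<Xi>) (min \<Xi> X)) - Y (-\<Xi>)) / \<kappa>" for X
  define h where "h X = S * W X - \<nu>\<^sup>2 * S * V X - Y X + C X" for X
  have conth: "continuous_on UNIV h"
  proof -
    have cY: "continuous_on UNIV Y" and cW: "continuous_on UNIV W"
      by (meson Y W DERIV_isCont continuous_at_imp_continuous_on)+
    have "continuous_on UNIV (\<lambda>X. Y (max (-\<Xi>) (min \<Xi> X)))"
      by (rule continuous_on_compose2[OF cY]) (auto intro!: continuous_intros)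
    then show ?thesis
      unfolding h_def C_def using pos by (intro continuous_intros cY cW Vc) auto
  qed
  have hweak: "(LINT x|lborel. h x * deriv (deriv \<phi>) x) = 0" if "test_function \<phi>" for \<phi>
    unfolding h_def
    by (rule weak_wave_equation_twice_integrated[OF pos(3) \<Xi> Vc weak Y W C_def that])
  have char: "S / l\<^sup>2 - \<nu>\<^sup>2 * S - 1 / l = 0"
  proof -
    define k where "k = lambda_minus \<nu> S"
    have "l + k = - 1 / (\<nu>\<^sup>2 * S)" "l * k = - 1 / \<nu>\<^sup>2"
      using lambda_sum[OF pos(1,2)] lambda_prod[OF pos(1,2)] by (simp_all add: l_def k_def)
    then have "\<nu>\<^sup>2 * S * (l + k) = - 1" "\<nu>\<^sup>2 * S * (l * k) = - S" using pos by simp_all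
    then have "\<nu>\<^sup>2 * S * l\<^sup>2 + l - S = 0" by algebra
    moreover have "S / l\<^sup>2 - \<nu>\<^sup>2 * S - 1 / l = - (\<nu>\<^sup>2 * S * l\<^sup>2 + l - S) / l\<^sup>2"
      using l by (simp add: diff_divide_distrib add_divide_distrib power2_eq_square)
    ultimately show ?thesis by simp
  qed
  have h_left: "h X = 0" if "X \<le> -\<Xi>" for X
  proof -
    have "max (-\<Xi>) (min \<Xi> X) = -\<Xi>" using that \<Xi> by simp
    then have "h X = \<eta> * exp (l * (X + \<Xi>)) * (S / l\<^sup>2 - \<nu>\<^sup>2 * S - 1 / l)"
      using that by (simp add: h_def C_def Yl Wl Vl algebra_simps)
    then show ?thesis by (simp add: char)
  qed
  have "h X = 0"
  proof (cases "X \<le> -\<Xi>")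
    case False
    then have "(X - (-\<Xi>)) * h (-\<Xi> - 1) - (X - (-\<Xi> - 1)) * h (-\<Xi>) + (-\<Xi> - (-\<Xi> - 1)) * h X = 0"
      by (intro three_point_affine_if_weak_second_derivative_zero[OF conth hweak]) auto
    then show ?thesis using h_left[of "-\<Xi>"] h_left[of "-\<Xi> - 1"] by simp
  qed (rule h_left)
  then show "\<nu>\<^sup>2 * S * V X = S * W X - Y X + (Y (max (-\<Xi>) (min \<Xi> X)) - Y (-\<Xi>)) / \<kappa>"
    by (simp add: h_def C_def)
qed

section \<open>The interface layer\<close>

lemma ln_one_plus_scaled_ge:
  fixes c t :: real
  assumes "0 \<le> c" "0 \<le> t" "t \<le> 1"
  shows "t * ln (1 + c) \<le> ln (1 + c * t)"
proof -
  have "ln ((1 - t) *\<^sub>R 1 + t *\<^sub>R (1 + c)) \<ge> (1 - t) * ln 1 + t * ln (1 + c)"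
    using assms by (intro concave_onD[OF ln_concave]) auto
  moreover have "(1 - t) *\<^sub>R 1 + t *\<^sub>R (1 + c) = 1 + c * t"
    by (simp add: algebra_simps)
  ultimately show ?thesis by (simp only: ln_one mult_zero_right add_0_left)
qed

text \<open>
  Here \<open>a\<close> is the value of \<open>Y\<close> where the layer is entered. The equation is compared with \<open>V = \<eta> + m * (Y - a)\<close>, for whose solutions \<open>ln (\<eta> + m * (Y - a))\<close> grows at the
  constant rate \<open>m\<close>. The only error is the increase of \<open>W\<close>; it is controlled by the crude bound on
  the width, which itself follows from dropping that nonnegative increase.
\<close>

lemma interface_layer_bounds:
  fixes N S a \<eta> \<kappa> \<Xi> :: real and V Y W :: "real \<Rightarrow> real"
  defines "K \<equiv> 2 * S * (a + 2) / (N * \<eta>\<^sup>2)" and "L \<equiv> ln (1 + 2 / (N * \<eta>))"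
  assumes pos: "0 < N" "0 < S" "0 < a" "0 < \<eta>" "0 < \<kappa>" "\<kappa> < 1" "0 < \<Xi>"
    and Vnn: "\<And>X. 0 \<le> V X"
    and Y: "\<And>X. (Y has_real_derivative V X) (at X)"
    and W: "\<And>X. (W has_real_derivative Y X) (at X)"
    and Yl: "Y (-\<Xi>) = a" and Yr: "Y \<Xi> = a + 2 * \<kappa>"
    and eq: "\<And>X. X \<in> {-\<Xi>..\<Xi>} \<Longrightarrow>
       N * V X = N * \<eta> + S * (W X - W (-\<Xi>)) + (1 / \<kappa> - 1) * (Y X - a)"
  shows "\<Xi> \<le> \<kappa> / \<eta>"
    and "N * \<kappa> / 2 * L / (1 + K * \<kappa>) \<le> \<Xi>"
    and "\<Xi> \<le> N * \<kappa> / 2 * L / (1 - \<kappa>)"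
    and "\<bar>V \<Xi> - (\<eta> + 2 / N)\<bar> \<le> (K * \<eta> + 2 / N) * \<kappa>"
    and "\<And>X. X \<in> {-\<Xi>..\<Xi>} \<Longrightarrow> Y X \<in> {a..a + 2 * \<kappa>}"
proof -
  have Ymono: "Y x \<le> Y y" if "x \<le> y" for x y
    using DERIV_nonneg_imp_nondecreasing[OF that] Y Vnn by blast
  show Yrange: "Y X \<in> {a..a + 2 * \<kappa>}" if "X \<in> {-\<Xi>..\<Xi>}" for X
    using Ymono[of "-\<Xi>" X] Ymono[of X \<Xi>] that Yl Yr by auto
  have Wbound: "0 \<le> W X - W (-\<Xi>) \<and> W X - W (-\<Xi>) \<le> (X + \<Xi>) * (a + 2 * \<kappa>)" if X: "X \<in> {-\<Xi><..\<Xi>}" for X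
  proof -
    obtain z where z: "-\<Xi> < z" "z < X" "W X - W (-\<Xi>) = (X - (-\<Xi>)) * Y z"
      using MVT2[of "-\<Xi>" X W Y, OF _ W] X unfolding greaterThanAtMost_iff by blast
    have "Y z \<in> {a..a + 2 * \<kappa>}" using z X by (intro Yrange) auto
    then show ?thesis using z pos X by (auto intro!: mult_nonneg_nonneg mult_left_mono)
  qed
  have Wnn: "0 \<le> W X - W (-\<Xi>)" if "X \<in> {-\<Xi>..\<Xi>}" for X
    using Wbound[of X] that by (cases "X = -\<Xi>") auto
  have kk: "1 / \<kappa> - 1 > 0" using pos by simp
  have V_ge: "\<eta> \<le> V X" if "X \<in> {-\<Xi>..\<Xi>}" for X
  proof -
    have "N * \<eta> \<le> N * V X"
      using eq[OF that] Wnn[OF that] Yrange[OF that] kk pos by simp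
    then show ?thesis using pos by simp
  qed
  show \<Xi>_le: "\<Xi> \<le> \<kappa> / \<eta>"
  proof -
    obtain z where z: "-\<Xi> < z" "z < \<Xi>" "Y \<Xi> - Y (-\<Xi>) = (\<Xi> - (-\<Xi>)) * V z"
      using MVT2[of "-\<Xi>" \<Xi> Y V, OF _ Y] pos by auto
    then have "2 * \<Xi> * \<eta> \<le> 2 * \<kappa>"
      using V_ge[of z] Yl Yr pos by (simp add: mult_left_mono)
    then show ?thesis using pos by (simp add: field_simps)
  qed
  have err: "S * (W X - W (-\<Xi>)) \<le> N * \<eta> * (K * \<kappa>)" if "X \<in> {-\<Xi>..\<Xi>}" for X
  proof (cases "X = -\<Xi>")
    case True
    then show ?thesis using pos by (simp add: K_def)
  next
    case False
    then have "W X - W (-\<Xi>) \<le> (X + \<Xi>) * (a + 2 * \<kappa>)" using Wbound[of X] that by auto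
    also have "\<dots> \<le> (2 * (\<kappa> / \<eta>)) * (a + 2)"
      using that \<Xi>_le pos by (intro mult_mono) auto
    finally have "S * (W X - W (-\<Xi>)) \<le> S * ((2 * (\<kappa> / \<eta>)) * (a + 2))"
      using pos by (intro mult_left_mono) auto
    also have "\<dots> = N * \<eta> * (K * \<kappa>)"
      using pos by (simp add: K_def field_simps power2_eq_square)
    finally show ?thesis .
  qed
  have Knn: "0 \<le> K" using pos by (simp add: K_def)
  define m where "m = (1 - \<kappa>) / (N * \<kappa>)"
  have m: "m > 0" using pos by (simp add: m_def)
  have Nm: "1 / \<kappa> - 1 = N * m" using pos by (simp add: m_def field_simps)
  have V_eq: "V X = (\<eta> + m * (Y X - a)) + S * (W X - W (-\<Xi>)) / N" if "X \<in> {-\<Xi>..\<Xi>}" for X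
    using eq[OF that] pos unfolding Nm by (simp add: field_simps)
  have base: "\<eta> \<le> \<eta> + m * (Y X - a)" if "X \<in> {-\<Xi>..\<Xi>}" for X
    using Yrange[OF that] m by simp
  have "\<exists>z. z > -\<Xi> \<and> z < \<Xi> \<and> ln (\<eta> + m * (Y \<Xi> - a)) - ln (\<eta> + m * (Y (-\<Xi>) - a))
      = (\<Xi> - (-\<Xi>)) * (m * V z / (\<eta> + m * (Y z - a)))"
  proof (intro MVT2)
    fix X assume "-\<Xi> \<le> X" "X \<le> \<Xi>"
    then have "\<eta> + m * (Y X - a) > 0" using base[of X] pos by simp
    then show "((\<lambda>X. ln (\<eta> + m * (Y X - a))) has_real_derivative m * V X / (\<eta> + m * (Y X - a))) (at X)"
      by (auto intro!: derivative_eq_intros Y)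
  qed (use pos in auto)
  then obtain z where z: "z \<in> {-\<Xi>..\<Xi>}" and lnz: "ln (\<eta> + m * (Y \<Xi> - a)) - ln (\<eta> + m * (Y (-\<Xi>) - a))
      = (\<Xi> - (-\<Xi>)) * (m * V z / (\<eta> + m * (Y z - a)))"
    unfolding atLeastAtMost_iff by (meson less_imp_le)
  \<comment> \<open>The factor \<open>\<kappa>\<close> in the increase of \<open>Y\<close> cancels the \<open>1 / \<kappa>\<close> in \<open>m\<close>, so the logarithm stays bounded.\<close>
  define c where "c = 2 / (N * \<eta>)"
  have c: "c > 0" using pos by (simp add: c_def)
  have "ln (\<eta> + m * (Y \<Xi> - a)) - ln (\<eta> + m * (Y (-\<Xi>) - a)) = ln ((\<eta> + m * (2 * \<kappa>)) / \<eta>)"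
  proof -
    have "0 < \<eta> + m * (2 * \<kappa>)" using pos m by (simp add: add_pos_pos)
    then show ?thesis using pos by (simp add: Yl Yr ln_div)
  qed
  also have "(\<eta> + m * (2 * \<kappa>)) / \<eta> = 1 + c * (1 - \<kappa>)"
    using pos by (simp add: m_def c_def field_simps)
  finally have lnc: "ln (1 + c * (1 - \<kappa>)) = 2 * \<Xi> * m * (V z / (\<eta> + m * (Y z - a)))"
    using lnz by simp
  have bz: "\<eta> + m * (Y z - a) > 0" using base[OF z] pos by simp
  have ratio_ge: "1 \<le> V z / (\<eta> + m * (Y z - a))"
    using V_eq[OF z] Wnn[OF z] pos bz by (simp add: le_divide_eq)
  have ratio_le: "V z / (\<eta> + m * (Y z - a)) \<le> 1 + K * \<kappa>"
  proof -
    have "S * (W z - W (-\<Xi>)) / N \<le> \<eta> * (K * \<kappa>)"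
      using err[OF z] pos by (simp add: divide_le_eq algebra_simps)
    also have "\<dots> \<le> (\<eta> + m * (Y z - a)) * (K * \<kappa>)"
      using base[OF z] Knn pos by (intro mult_right_mono) auto
    finally have "V z \<le> (1 + K * \<kappa>) * (\<eta> + m * (Y z - a))"
      using V_eq[OF z] by (simp add: algebra_simps)
    then show ?thesis using bz by (simp add: divide_le_eq)
  qed
  have twom: "2 * m = (1 - \<kappa>) / (N * \<kappa> / 2)" using pos by (simp add: m_def field_simps)
  have "\<Xi> * (2 * m) \<le> ln (1 + c * (1 - \<kappa>))"
    unfolding lnc using mult_left_mono[OF ratio_ge, of "2 * \<Xi> * m"] pos m by (simp add: ac_simps)
  also have "\<dots> \<le> L"
    unfolding L_def c_def[symmetric] using c pos mult_left_mono[of "1 - \<kappa>" 1 c]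
    by (simp add: add_pos_nonneg)
  finally show "\<Xi> \<le> N * \<kappa> / 2 * L / (1 - \<kappa>)"
    unfolding twom using pos by (simp add: field_simps)
  have "(1 - \<kappa>) * L \<le> ln (1 + c * (1 - \<kappa>))"
    unfolding L_def c_def[symmetric] using c pos by (intro ln_one_plus_scaled_ge) auto
  also have "\<dots> \<le> \<Xi> * (2 * m) * (1 + K * \<kappa>)"
    unfolding lnc using mult_left_mono[OF ratio_le, of "2 * \<Xi> * m"] pos m by (simp add: ac_simps)
  finally have "(1 - \<kappa>) * L \<le> (1 - \<kappa>) * (\<Xi> * (1 + K * \<kappa>) / (N * \<kappa> / 2))"
    unfolding twom by (simp add: algebra_simps)
  then have "L \<le> \<Xi> * (1 + K * \<kappa>) / (N * \<kappa> / 2)"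
    by (subst (asm) mult_le_cancel_left_pos) (use pos in auto)
  then have "N * \<kappa> / 2 * L \<le> \<Xi> * (1 + K * \<kappa>)"
    using pos by (simp add: field_simps)
  moreover have "1 + K * \<kappa> > 0" using Knn pos by (simp add: add_pos_nonneg)
  ultimately show "N * \<kappa> / 2 * L / (1 + K * \<kappa>) \<le> \<Xi>"
    by (simp only: pos_divide_le_eq)
  have \<Xi>in: "\<Xi> \<in> {-\<Xi>..\<Xi>}" using pos by simp
  have "V \<Xi> - (\<eta> + 2 / N) = S * (W \<Xi> - W (-\<Xi>)) / N - 2 / N * \<kappa>"
  proof -
    have "m * (Y \<Xi> - a) = 2 / N * (1 - \<kappa>)" using pos by (simp add: Yr m_def)
    also have "\<dots> = 2 / N - 2 / N * \<kappa>" by (simp add: right_diff_distrib)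
    finally show ?thesis using V_eq[OF \<Xi>in] by simp
  qed
  moreover have "S * (W \<Xi> - W (-\<Xi>)) / N \<le> K * \<eta> * \<kappa>"
    using err[OF \<Xi>in] pos by (simp add: divide_le_eq algebra_simps)
  moreover have "0 \<le> S * (W \<Xi> - W (-\<Xi>)) / N" using Wnn[OF \<Xi>in] pos by simp
  moreover have "0 \<le> 2 / N * \<kappa>" "0 \<le> K * \<eta> * \<kappa>" using pos Knn by auto
  ultimately show "\<bar>V \<Xi> - (\<eta> + 2 / N)\<bar> \<le> (K * \<eta> + 2 / N) * \<kappa>"
    unfolding distrib_right by linarith
qed

section \<open>The wave outside the interface\<close>

text \<open>
  The second-order operator with characteristic roots \<open>p\<close> and \<open>q\<close> factors into first-order ones, so
  \<open>V - q * Y\<close> is a pure exponential of rate \<open>p\<close>. Exchanging the roots gives a second such identity,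
  and \<open>Y\<close> is a multiple of their difference.
\<close>

lemma outer_first_order_factor:
  fixes N S p q d \<Xi> :: real and V Y W :: "real \<Rightarrow> real"
  assumes "0 < N" and sum: "N * (p + q) = - 1" and prod: "N * (p * q) = - S"
    and Y: "\<And>X. (Y has_real_derivative V X) (at X)"
    and W: "\<And>X. (W has_real_derivative Y X) (at X)"
    and eq: "\<And>X. \<Xi> \<le> X \<Longrightarrow> N * V X = S * W X - Y X + d"
    and "\<Xi> \<le> X"
  shows "V X - q * Y X = (V \<Xi> - q * Y \<Xi>) * exp (p * (X - \<Xi>))"
proof -
  \<comment> \<open>\<open>V\<close> need not be differentiable at \<open>\<Xi>\<close> itself, so it is replaced by a differentiable function that agrees with it on the half-line.\<close>
  define Z where "Z X = (S * W X - Y X + d) / N" for X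
  define F where "F X = (Z X - q * Y X) * exp (- p * X)" for X
  have ZV: "Z X = V X" if "\<Xi> \<le> X" for X
    using eq[OF that] \<open>0 < N\<close> by (simp add: Z_def field_simps)
  have VF: "V X - q * Y X = F X * exp (p * X)" if "\<Xi> \<le> X" for X
    by (simp add: F_def ZV[OF that] mult.assoc flip: exp_add)
  have "((\<lambda>X. S * W X - Y X + d) has_real_derivative S * Y X - V X) (at X)" for X
    by (auto intro!: derivative_eq_intros Y W)
  then have dZ: "(Z has_real_derivative (S * Y X - V X) / N) (at X)" for X
    unfolding Z_def by (rule DERIV_cdivide)
  have dF: "(F has_real_derivative ((S * Y X - V X) / N - q * V X - p * (Z X - q * Y X)) * exp (- p * X)) (at X)" for X
  proof -
    have "((\<lambda>X. exp (- p * X)) has_real_derivative - p * exp (- p * X)) (at X)"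
      by (auto intro!: derivative_eq_intros)
    from DERIV_mult[OF DERIV_diff[OF dZ DERIV_cmult[OF Y]] this] show ?thesis
      unfolding F_def by (rule DERIV_cong) (simp add: algebra_simps)
  qed
  have zero: "((S * Y X - V X) / N - q * V X - p * (Z X - q * Y X)) * exp (- p * X) = 0"
    if "\<Xi> \<le> X" for X
  proof -
    have "S * Y X - V X = N * (q * V X + p * (V X - q * Y X))"
      using sum prod by algebra
    then have "(S * Y X - V X) / N = q * V X + p * (V X - q * Y X)" using \<open>0 < N\<close> by simp
    then show ?thesis unfolding ZV[OF that] by simp
  qed
  have "F X = F \<Xi>"
    by (rule eq_on_if_same_derivative[where A = "{\<Xi>..}" and G = "\<lambda>_. F \<Xi>" and a = \<Xi>, OF dF DERIV_const])
      (use zero \<open>\<Xi> \<le> X\<close> in auto)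
  moreover have "exp (p * X) = exp (p * \<Xi>) * exp (p * (X - \<Xi>))"
    by (simp add: algebra_simps flip: exp_add)
  ultimately show ?thesis using VF[OF \<open>\<Xi> \<le> X\<close>] VF[of \<Xi>] by simp
qed

text \<open>
  The rates and the constants \<open>K\<close> and \<open>L\<close> do not involve \<open>\<kappa>\<close>, so every clause can be passed to
  the limit as it stands.
\<close>

lemma relevant_wave_structure:
  fixes \<nu> S \<eta> \<kappa> \<Xi> :: real and V U :: "real \<Rightarrow> real"
  defines "N \<equiv> \<nu>\<^sup>2 * S" and "l \<equiv> lambda_plus \<nu> S" and "k \<equiv> lambda_minus \<nu> S"
  defines "K \<equiv> 2 * S * (\<eta> / l + 2) / (N * \<eta>\<^sup>2)" and "L \<equiv> ln (1 + 2 / (N * \<eta>))"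
  assumes pos: "0 < \<nu>" "0 < S" "0 < \<eta>" "0 < \<kappa>" "\<kappa> < 1"
    and wave: "relevant_wave \<nu> \<kappa> S \<eta> \<Xi> V"
    and profile: "wave_profile \<kappa> \<Xi> V U"
  shows "0 < \<Xi>" and "\<Xi> \<le> \<kappa> / \<eta>"
    and "N * \<kappa> / 2 * L / (1 + K * \<kappa>) \<le> \<Xi>"
    and "\<Xi> \<le> N * \<kappa> / 2 * L / (1 - \<kappa>)"
    and "\<bar>V \<Xi> - (\<eta> + 2 / N)\<bar> \<le> (K * \<eta> + 2 / N) * \<kappa>"
    and "X \<le> -\<Xi> \<Longrightarrow> U X = \<eta> / l * (exp (l * (X + \<Xi>)) - 1) - \<kappa>"
    and "\<bar>U 0\<bar> \<le> \<kappa>"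
    and "\<Xi> \<le> X \<Longrightarrow> (l - k) * (U X + \<kappa> + \<eta> / l)
      = (V \<Xi> - k * (\<eta> / l + 2 * \<kappa>)) * exp (l * (X - \<Xi>)) - (V \<Xi> - l * (\<eta> / l + 2 * \<kappa>)) * exp (k * (X - \<Xi>))"
proof -
  define a where "a = \<eta> / l"
  have l: "l > 0" using lambda_plus_pos[OF pos(1,2)] by (simp add: l_def)
  have N: "N > 0" and a: "a > 0" using pos l by (simp_all add: N_def a_def)
  show \<Xi>: "0 < \<Xi>" using wave by (simp add: relevant_wave_def)
  have Vnn: "0 \<le> V X" and Vint: "integral {-\<Xi>..\<Xi>} V = 2 * \<kappa>" for X
    using wave by (auto simp: relevant_wave_def traveling_wave_solution_def)
  define Y where "Y X = U X + \<kappa> + a" for X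
  have Y: "(Y has_real_derivative V X) (at X)" for X
    using profile unfolding Y_def wave_profile_def by (auto intro!: derivative_eq_intros)
  have Yl: "Y (-\<Xi>) = a" using profile by (simp add: Y_def wave_profile_def)
  have Yr: "Y \<Xi> = a + 2 * \<kappa>"
  proof -
    have "(V has_integral (Y \<Xi> - Y (-\<Xi>))) {-\<Xi>..\<Xi>}"
      using \<Xi> Y by (intro fundamental_theorem_of_calculus)
        (auto simp: has_real_derivative_iff_has_vector_derivative[symmetric] intro: has_field_derivative_at_within)
    then have "integral {-\<Xi>..\<Xi>} V = Y \<Xi> - Y (-\<Xi>)" by (rule integral_unique)
    then show ?thesis using Vint Yl by simp
  qed
  have "continuous_on UNIV Y"
    by (meson Y DERIV_isCont continuous_at_imp_continuous_on)
  then obtain W where W0: "W (-\<Xi>) = \<eta> / l\<^sup>2" and W: "\<And>X. (W has_real_derivative Y X) (at X)"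
    by (rule real_antiderivative[where a = "-\<Xi>" and c = "\<eta> / l\<^sup>2"]) blast
  note int = relevant_wave_integrated[OF pos(1,2,4) wave Y _ W, folded l_def N_def, OF Yl[unfolded a_def] W0]
  have inner: "N * V X = N * \<eta> + S * (W X - W (-\<Xi>)) + (1 / \<kappa> - 1) * (Y X - a)" if "X \<in> {-\<Xi>..\<Xi>}" for X
  proof -
    have "V (-\<Xi>) = \<eta>" using wave by (simp add: relevant_wave_def)
    then have "N * \<eta> = S * W (-\<Xi>) - a" using int(2)[of "-\<Xi>"] \<Xi> Yl by simp
    moreover have "N * V X = S * W X - Y X + (Y X - a) / \<kappa>"
    proof -
      have "max (-\<Xi>) (min \<Xi> X) = X" using that by auto
      then show ?thesis using int(2)[of X] Yl by simp
    qed
    ultimately show ?thesis by (simp add: algebra_simps diff_divide_distrib)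
  qed
  note layer = interface_layer_bounds[OF N pos(2) a pos(3-5) \<Xi> Vnn Y W Yl Yr inner]
  show "\<Xi> \<le> \<kappa> / \<eta>" "N * \<kappa> / 2 * L / (1 + K * \<kappa>) \<le> \<Xi>" "\<Xi> \<le> N * \<kappa> / 2 * L / (1 - \<kappa>)"
    "\<bar>V \<Xi> - (\<eta> + 2 / N)\<bar> \<le> (K * \<eta> + 2 / N) * \<kappa>"
    using layer(1-4) unfolding K_def L_def a_def by blast+
  show "U X = \<eta> / l * (exp (l * (X + \<Xi>)) - 1) - \<kappa>" if "X \<le> -\<Xi>"
    using int(1)[OF that] by (simp add: Y_def a_def algebra_simps)
  show "\<bar>U 0\<bar> \<le> \<kappa>"
    using layer(5)[of 0] \<Xi> by (simp add: Y_def abs_le_iff)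
  show "(l - k) * (U X + \<kappa> + \<eta> / l)
      = (V \<Xi> - k * (\<eta> / l + 2 * \<kappa>)) * exp (l * (X - \<Xi>)) - (V \<Xi> - l * (\<eta> / l + 2 * \<kappa>)) * exp (k * (X - \<Xi>))"
    if "\<Xi> \<le> X"
  proof -
    have outer: "N * V X = S * W X - Y X + 2" if "\<Xi> \<le> X" for X
      using int(2)[of X] that \<Xi> pos by (simp add: Yl Yr)
    have vieta: "N * (l + k) = - 1" "N * (l * k) = - S"
      using lambda_sum[OF pos(1,2)] lambda_prod[OF pos(1,2)] pos
      by (simp_all add: l_def k_def N_def)
    then have vieta': "N * (k + l) = - 1" "N * (k * l) = - S" by (simp_all add: add.commute mult.commute)
    have "V X - k * Y X = (V \<Xi> - k * Y \<Xi>) * exp (l * (X - \<Xi>))"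
      by (rule outer_first_order_factor[OF N vieta Y W outer that])
    moreover have "V X - l * Y X = (V \<Xi> - l * Y \<Xi>) * exp (k * (X - \<Xi>))"
      by (rule outer_first_order_factor[OF N vieta' Y W outer that])
    ultimately have "(l - k) * Y X = (V \<Xi> - k * Y \<Xi>) * exp (l * (X - \<Xi>)) - (V \<Xi> - l * Y \<Xi>) * exp (k * (X - \<Xi>))"
      by (simp add: algebra_simps)
    then show ?thesis by (simp only: Yr) (simp only: Y_def a_def)
  qed
qed

section \<open>The limit of vanishing spinodal region\<close>

theorem theorem5:
  fixes \<nu> S \<eta> :: real
    and \<Xi> :: "real \<Rightarrow> real"
    and V U :: "real \<Rightarrow> real \<Rightarrow> real"
  assumes "0 < \<nu>" and "0 < S" and "0 < \<eta>"
    and wave: "\<And>\<kappa>. 0 < \<kappa> \<Longrightarrow> \<kappa> < 1 \<Longrightarrow> relevant_wave \<nu> \<kappa> S \<eta> (\<Xi> \<kappa>) (V \<kappa>)"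
    and profile: "\<And>\<kappa>. 0 < \<kappa> \<Longrightarrow> \<kappa> < 1 \<Longrightarrow> wave_profile \<kappa> (\<Xi> \<kappa>) (V \<kappa>) (U \<kappa>)"
  shows "(\<exists>r. r \<in> O[at_right 0](\<lambda>\<kappa>. \<kappa>) \<and>
            (\<forall>\<kappa>. 0 < \<kappa> \<longrightarrow> \<kappa> < 1 \<longrightarrow>
               \<Xi> \<kappa> = \<nu>\<^sup>2 * S * \<kappa> / 2 * ln (1 + 2 / (\<nu>\<^sup>2 * S * \<eta>)) * (1 + r \<kappa>))) \<and>
         (\<Xi> \<longlongrightarrow> 0) (at_right 0) \<and>
         (\<forall>X. ((\<lambda>\<kappa>. U \<kappa> X) \<longlongrightarrow>
            \<eta> / lambda_plus \<nu> S * (exp (lambda_plus \<nu> S * X) - 1)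
            + 2 / sqrt (1 + 4 * \<nu>\<^sup>2 * S\<^sup>2)
              * (if X < 0 then 0
                 else exp (lambda_plus \<nu> S * X) - exp (lambda_minus \<nu> S * X))) (at_right 0))"
proof -
  define N where "N = \<nu>\<^sup>2 * S"
  define l where "l = lambda_plus \<nu> S"
  define k where "k = lambda_minus \<nu> S"
  define K where "K = 2 * S * (\<eta> / l + 2) / (N * \<eta>\<^sup>2)"
  define L where "L = ln (1 + 2 / (N * \<eta>))"
  have l: "l > 0" using lambda_plus_pos[OF assms(1,2)] by (simp add: l_def)
  have N: "N > 0" using assms(1,2) by (simp add: N_def)
  have L: "L > 0" unfolding L_def using N assms(3) by (intro ln_gt_zero) simp
  have K: "K \<ge> 0" using N l assms(2,3) by (simp add: K_def)
  note facts = relevant_wave_structure[OF assms(1-3) _ _ wave profile,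
      folded N_def l_def k_def, folded K_def L_def]
  have small: "\<forall>\<^sub>F \<kappa> in at_right (0::real). 0 < \<kappa> \<and> \<kappa> < \<delta>" if "\<delta> > 0" for \<delta>
    using eventually_at_right_real[OF that] by simp

  define r where "r \<kappa> = \<Xi> \<kappa> / (N * \<kappa> / 2 * L) - 1" for \<kappa>
  have \<Xi>_eq: "\<Xi> \<kappa> = N * \<kappa> / 2 * L * (1 + r \<kappa>)" if "0 < \<kappa>" for \<kappa>
    using that N L by (simp add: r_def)
  \<comment> \<open>Below \<open>1 / 2\<close> the bound \<open>1 / (1 - \<kappa>)\<close> is at most \<open>1 + 2 * \<kappa>\<close>.\<close>
  have "\<bar>r \<kappa>\<bar> \<le> (K + 2) * \<bar>\<kappa>\<bar>" if "0 < \<kappa> \<and> \<kappa> < 1 / 2" for \<kappa>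
  proof -
    have \<kappa>: "0 < \<kappa>" "\<kappa> < 1" "\<kappa> < 1 / 2" using that by auto
    have D: "N * \<kappa> / 2 * L > 0" using N L \<kappa> by simp
    have K1: "1 + K * \<kappa> > 0" using K \<kappa> by (simp add: add_pos_nonneg)
    have "N * \<kappa> / 2 * L * (1 / (1 + K * \<kappa>)) \<le> N * \<kappa> / 2 * L * (1 + r \<kappa>)"
      using facts(3)[OF \<kappa>(1,2) \<kappa>(1,2) \<kappa>(1,2)] \<Xi>_eq[OF \<kappa>(1)] by simp
    then have lower: "1 / (1 + K * \<kappa>) \<le> 1 + r \<kappa>" using D by (simp only: mult_le_cancel_left_pos)
    have "N * \<kappa> / 2 * L * (1 + r \<kappa>) \<le> N * \<kappa> / 2 * L * (1 / (1 - \<kappa>))"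
      using facts(4)[OF \<kappa>(1,2) \<kappa>(1,2) \<kappa>(1,2)] \<Xi>_eq[OF \<kappa>(1)] by simp
    then have upper: "1 + r \<kappa> \<le> 1 / (1 - \<kappa>)" using D by (simp only: mult_le_cancel_left_pos)
    have "(1 - K * \<kappa>) * (1 + K * \<kappa>) \<le> 1"
      using zero_le_square[of "K * \<kappa>"] by (simp add: algebra_simps)
    then have "1 - K * \<kappa> \<le> 1 / (1 + K * \<kappa>)" using K1 by (simp add: le_divide_eq)
    moreover have "1 / (1 - \<kappa>) \<le> 1 + 2 * \<kappa>"
    proof -
      have "\<kappa> * (1 - 2 * \<kappa>) \<ge> 0" using \<kappa> by simp
      then have "1 \<le> (1 + 2 * \<kappa>) * (1 - \<kappa>)" by (simp add: algebra_simps)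
      then show ?thesis using \<kappa> by (simp add: divide_le_eq)
    qed
    ultimately have "- (K * \<kappa>) \<le> r \<kappa>" "r \<kappa> \<le> 2 * \<kappa>" using lower upper by linarith+
    moreover have "0 \<le> K * \<kappa>" using K \<kappa> by simp
    ultimately show ?thesis using \<kappa> by (simp add: distrib_right)
  qed
  then have "r \<in> O[at_right 0](\<lambda>\<kappa>. \<kappa>)"
    by (intro bigoI[where c = "K + 2"] eventually_mono[OF small[of "1 / 2"]]) auto
  then have part1: "\<exists>r. r \<in> O[at_right 0](\<lambda>\<kappa>. \<kappa>) \<and> (\<forall>\<kappa>. 0 < \<kappa> \<longrightarrow> \<kappa> < 1 \<longrightarrow>
      \<Xi> \<kappa> = N * \<kappa> / 2 * L * (1 + r \<kappa>))"
    using \<Xi>_eq by blast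

  have id0: "((\<lambda>\<kappa>::real. \<kappa>) \<longlongrightarrow> 0) (at_right 0)" by (rule tendsto_ident_at)
  have part2: "(\<Xi> \<longlongrightarrow> 0) (at_right 0)"
  proof (rule tendsto_sandwich)
    show "\<forall>\<^sub>F \<kappa> in at_right 0. 0 \<le> \<Xi> \<kappa>"
      by (rule eventually_mono[OF small[of 1]]) (auto intro: less_imp_le facts(1))
    show "\<forall>\<^sub>F \<kappa> in at_right 0. \<Xi> \<kappa> \<le> \<kappa> / \<eta>"
      by (rule eventually_mono[OF small[of 1]]) (auto intro: facts(2))
    show "((\<lambda>\<kappa>. \<kappa> / \<eta>) \<longlongrightarrow> 0) (at_right 0)"
      using tendsto_divide[OF id0 tendsto_const[of \<eta>]] assms(3) by simp
  qed simp

  have V_lim: "((\<lambda>\<kappa>. V \<kappa> (\<Xi> \<kappa>)) \<longlongrightarrow> \<eta> + 2 / N) (at_right 0)"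
  proof -
    have "((\<lambda>\<kappa>. (K * \<eta> + 2 / N) * \<kappa>) \<longlongrightarrow> 0) (at_right 0)"
      using tendsto_mult_left[OF id0, of "K * \<eta> + 2 / N"] by simp
    moreover have "\<forall>\<^sub>F \<kappa> in at_right 0. norm (V \<kappa> (\<Xi> \<kappa>) - (\<eta> + 2 / N)) \<le> (K * \<eta> + 2 / N) * \<kappa>"
      by (rule eventually_mono[OF small[of 1]]) (auto intro: facts(5))
    ultimately have "((\<lambda>\<kappa>. V \<kappa> (\<Xi> \<kappa>) - (\<eta> + 2 / N)) \<longlongrightarrow> 0) (at_right 0)"
      by (rule Lim_null_comparison[rotated])
    then show ?thesis by (simp add: LIM_zero_iff)
  qed
  have gap: "l - k = sqrt (1 + 4 * \<nu>\<^sup>2 * S\<^sup>2) / N"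
    using lambda_gap[OF assms(1,2)] by (simp add: l_def k_def N_def)
  have gap_pos: "l - k > 0"
  proof -
    have "0 < 1 + 4 * \<nu>\<^sup>2 * S\<^sup>2" by (simp add: add_pos_nonneg)
    then show ?thesis using N unfolding gap by simp
  qed
  have gap': "2 / N / (l - k) = 2 / sqrt (1 + 4 * \<nu>\<^sup>2 * S\<^sup>2)"
    using N by (simp add: gap)

  have part3: "((\<lambda>\<kappa>. U \<kappa> X) \<longlongrightarrow>
      \<eta> / l * (exp (l * X) - 1) + 2 / sqrt (1 + 4 * \<nu>\<^sup>2 * S\<^sup>2) * (if X < 0 then 0 else exp (l * X) - exp (k * X)))
      (at_right 0)" for X
  proof -
    consider "X < 0" | "X = 0" | "X > 0" by linarith
    then show ?thesis
    proof cases
      case 1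
      have "\<forall>\<^sub>F \<kappa> in at_right 0. \<Xi> \<kappa> < - X"
        using order_tendstoD(2)[OF part2, of "- X"] 1 by simp
      with small[OF zero_less_one]
      have "\<forall>\<^sub>F \<kappa> in at_right 0. \<eta> / l * (exp (l * (X + \<Xi> \<kappa>)) - 1) - \<kappa> = U \<kappa> X"
      proof eventually_elim
        case (elim \<kappa>)
        then have \<kappa>: "0 < \<kappa>" "\<kappa> < 1" "X \<le> - \<Xi> \<kappa>" by auto
        show ?case using facts(6)[OF \<kappa>(1,2) \<kappa>(1,2) \<kappa>] by simp
      qed
      moreover have "((\<lambda>\<kappa>. \<eta> / l * (exp (l * (X + \<Xi> \<kappa>)) - 1) - \<kappa>) \<longlongrightarrow>
          \<eta> / l * (exp (l * (X + 0)) - 1) - 0) (at_right 0)"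
        by (intro tendsto_intros part2 id0)
      ultimately show ?thesis using 1 by (simp add: tendsto_cong)
    next
      case 2
      have "\<forall>\<^sub>F \<kappa> in at_right 0. norm (U \<kappa> 0) \<le> \<kappa>"
        by (rule eventually_mono[OF small[of 1]]) (auto intro: facts(7))
      then have "((\<lambda>\<kappa>. U \<kappa> 0) \<longlongrightarrow> 0) (at_right 0)"
        by (rule Lim_null_comparison) (rule id0)
      then show ?thesis using 2 by simp
    next
      case 3
      let ?E = "\<lambda>\<kappa>. ((V \<kappa> (\<Xi> \<kappa>) - k * (\<eta> / l + 2 * \<kappa>)) * exp (l * (X - \<Xi> \<kappa>))
          - (V \<kappa> (\<Xi> \<kappa>) - l * (\<eta> / l + 2 * \<kappa>)) * exp (k * (X - \<Xi> \<kappa>))) / (l - k) - \<eta> / l - \<kappa>"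
      have U_eq: "?E \<kappa> = U \<kappa> X" if "0 < \<kappa>" "\<kappa> < 1" "\<Xi> \<kappa> \<le> X" for \<kappa>
        using facts(8)[OF that(1,2) that(1,2) that(1,2,3), symmetric] gap_pos by simp
      have "\<forall>\<^sub>F \<kappa> in at_right 0. \<Xi> \<kappa> < X"
        using order_tendstoD(2)[OF part2, of X] 3 by simp
      with small[OF zero_less_one] have ev: "\<forall>\<^sub>F \<kappa> in at_right 0. ?E \<kappa> = U \<kappa> X"
        by eventually_elim (intro U_eq; simp)
      have "(?E \<longlongrightarrow> ((\<eta> + 2 / N - k * (\<eta> / l + 2 * 0)) * exp (l * (X - 0))
          - (\<eta> + 2 / N - l * (\<eta> / l + 2 * 0)) * exp (k * (X - 0))) / (l - k) - \<eta> / l - 0) (at_right 0)"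
        using gap_pos by (intro tendsto_intros part2 id0 V_lim) auto
      then have lim: "((\<lambda>\<kappa>. U \<kappa> X) \<longlongrightarrow> ((\<eta> + 2 / N - k * (\<eta> / l)) * exp (l * X)
          - 2 / N * exp (k * X)) / (l - k) - \<eta> / l) (at_right 0)"
        using l by (simp add: tendsto_cong[OF ev])
      have "\<eta> + 2 / N - k * (\<eta> / l) = (l - k) * (\<eta> / l) + 2 / N"
        using l by (simp add: field_simps)
      then have "((\<eta> + 2 / N - k * (\<eta> / l)) * exp (l * X) - 2 / N * exp (k * X)) / (l - k) - \<eta> / l
          = ((l - k) * (\<eta> / l * exp (l * X)) + 2 / N * (exp (l * X) - exp (k * X))) / (l - k) - \<eta> / l"
        by (simp only:) (simp add: algebra_simps)
      also have "\<dots> = \<eta> / l * (exp (l * X) - 1) + 2 / N / (l - k) * (exp (l * X) - exp (k * X))"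
      proof -
        have "(g * A + B * C) / g = A + B / g * C" if "g > 0" for g A B C :: real
          using that by (simp add: add_divide_distrib)
        note cancel = this[OF gap_pos]
        show ?thesis unfolding cancel by (simp add: right_diff_distrib)
      qed
      finally show ?thesis using lim 3 unfolding gap' by simp
    qed
  qed
  show ?thesis
    using part1 part2 part3 unfolding N_def L_def l_def k_def by blast
qed

end
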